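(* RFD is scale invariant, in the following sense. (i) (Additive shifts and positive scaling of the cost.) Let $\mathbf{J}$ be a random cost function, $a>0$, $b\in\mathbb{R}$, and $\tilde{\mathbf{J}}(w):=a\mathbf{J}(w)+b$. If $(W_n)_n$ are the RFD iterates for $\mathbf{J}$ started in $w_0$ and $(\tilde W_n)_n$ are the RFD iterates for $\tilde{\mathbf{J}}$ started in $\tilde w_0=w_0$, then $\tilde W_n=W_n$ almost surely for all $n$. (ii) (Bijections of the input.) Let $M,N\subseteq\mathbb{R}^d$ be open, let $\phi:M\to N$ be a differentiable bijection whose Jacobian is invertible everywhere, let $\mathbf{J}$ be a random cost function on $N$ and $\tilde{\mathbf{J}}:=\mathbf{J}\circ\phi$ on $M$. If $(W_n)_n$ are the RFD iterates for $\mathbf{J}$ started in $w_0\in N$ and $(\tilde W_n)_n$ are the RFD iterates for $\tilde{\mathbf{J}}$ started in $\tilde w_0=\phi^{-1}(w_0)$, then $\tilde W_n=\phi^{-1}(W_n)$ almost surely for all $n$.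
   Context: A random cost function is a Gaussian random function $\mathbf{J}$ on an open set $N\subseteq\mathbb{R}^d$ with continuously differentiable sample paths and sufficiently smooth mean and covariance function (for $\mathbf{J}\circ\phi$, differentiability of the paths is inherited from $\mathbf{J}$ and $\phi$). Random Function Descent (RFD) minimizes the first order stochastic Taylor approximation: $w_{n+1}:=\operatorname{argmin}_{w}\mathbb{E}[\mathbf{J}(w)\mid\mathbf{J}(w_n),\nabla\mathbf{J}(w_n)]$. Formally: for deterministic $w,\theta$, let $\varphi_{w,\theta}(j,g)$ be the function with $\varphi_{w,\theta}(\mathbf{J}(w),\nabla\mathbf{J}(w))=\mathbb{E}[\mathbf{J}(\theta)\mid\mathbf{J}(w),\nabla\mathbf{J}(w)]$ almost surely that is given by the Gaussian conditioning formula, i.e. with $X(w)=(\mathbf{J}(w),\nabla\mathbf{J}(w))$, $$\varphi_{w,\theta}(x)=\mathbb{E}[\mathbf{J}(\theta)]+\operatorname{Cov}(\mathbf{J}(\theta),X(w))\operatorname{Cov}(X(w))^{+}(x-\mathbb{E}[X(w)]),$$ where ${}^{+}$ is the (Moore–Penrose pseudo-)inverse. Put $\Phi_{\mathbb{P}_{\mathbf{J}}}(w,j,g):=\operatorname{argmin}_{\theta}\varphi_{w,\theta}(j,g)$, the minimum being over the domain of $\mathbf{J}$. The RFD iterates started in the deterministic point $w_0$ are $W_0:=w_0$, $W_{n+1}:=\Phi_{\mathbb{P}_{\mathbf{J}}}(W_n,\mathbf{J}(W_n),\nabla\mathbf{J}(W_n))$. Minimizers are treated as existing and being unique along the iterations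 considered. *)

theory Defs
  imports "HOL-Probability.Probability"
begin

definition grad :: "(real ^ 'n \<Rightarrow> real) \<Rightarrow> real ^ 'n \<Rightarrow> real ^ 'n" where
  "grad f x = (THE D. GDERIV f x :> D)"

definition continuously_differentiable_on :: "(real ^ 'n \<Rightarrow> real) \<Rightarrow> (real ^ 'n) set \<Rightarrow> bool" where
  "continuously_differentiable_on f N \<longleftrightarrow>
     (\<forall>x\<in>N. f differentiable (at x)) \<and> continuous_on N (grad f)"

text \<open>Smoothness asked of a covariance function: the mixed second derivatives
  \<open>\<partial>/\<partial>t\<^sub>j \<partial>/\<partial>s\<^sub>i K(s,t)\<close> exist and are jointly continuous.  This is the smoothness that a
  Gaussian random function with continuously differentiable paths needs in order that the
  covariances of its gradient be the mixed derivatives of \<open>K\<close>.\<close>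

definition smooth_covariance_on :: "(real ^ 'n \<Rightarrow> real ^ 'n \<Rightarrow> real) \<Rightarrow> (real ^ 'n) set \<Rightarrow> bool" where
  "smooth_covariance_on K N \<longleftrightarrow>
     (\<forall>s\<in>N. \<forall>t\<in>N. (\<lambda>s'. K s' t) differentiable (at s)) \<and>
     (\<forall>s\<in>N. \<forall>t\<in>N. \<forall>i. (\<lambda>t'. grad (\<lambda>s'. K s' t') s $ i) differentiable (at t)) \<and>
     (\<forall>i. continuous_on (N \<times> N) (\<lambda>(s, t). grad (\<lambda>t'. grad (\<lambda>s'. K s' t') s $ i) t))"

definition covariance :: "'w measure \<Rightarrow> ('w \<Rightarrow> real) \<Rightarrow> ('w \<Rightarrow> real) \<Rightarrow> real" where
  "covariance P X Y =
     (LINT \<omega>|P. (X \<omega> - (LINT \<omega>'|P. X \<omega>')) * (Y \<omega> - (LINT \<omega>'|P. Y \<omega>')))"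

text \<open>Degenerate (almost surely constant) Gaussians are allowed.\<close>

definition gaussian_rv :: "'w measure \<Rightarrow> ('w \<Rightarrow> real) \<Rightarrow> bool" where
  "gaussian_rv P Y \<longleftrightarrow> Y \<in> borel_measurable P \<and>
     ((\<exists>\<mu> \<sigma>. \<sigma> > 0 \<and> distributed P lborel Y (normal_density \<mu> \<sigma>)) \<or>
      (\<exists>\<mu>. AE \<omega> in P. Y \<omega> = \<mu>))"

text \<open>A random function on \<open>N\<close> is a function \<open>J w \<omega>\<close>, of which only the values with
  \<open>w \<in> N\<close> matter.  As usual, a family is Gaussian if all its finite linear combinations are.\<close>

locale random_cost_function = prob_space P
  for P :: "'w measure" +
  fixes N :: "(real ^ 'n) set"
    and J :: "real ^ 'n \<Rightarrow> 'w \<Rightarrow> real"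
  assumes open_domain: "open N"
    and gaussian: "\<And>F c. finite F \<Longrightarrow> F \<subseteq> N \<Longrightarrow> gaussian_rv P (\<lambda>\<omega>. \<Sum>w\<in>F. c w * J w \<omega>)"
    and C1_paths: "\<And>\<omega>. \<omega> \<in> space P \<Longrightarrow> continuously_differentiable_on (\<lambda>w. J w \<omega>) N"
    and C1_mean: "continuously_differentiable_on (\<lambda>w. expectation (J w)) N"
    and smooth_covariance: "smooth_covariance_on (\<lambda>s t. covariance P (J s) (J t)) N"

definition pseudo_inverse :: "real ^ 'n ^ 'm \<Rightarrow> real ^ 'm ^ 'n" where
  "pseudo_inverse A = (THE B.
     A ** B ** A = A \<and> B ** A ** B = B \<and>
     transpose (A ** B) = A ** B \<and> transpose (B ** A) = B ** A)"

text \<open>The vector \<open>(j, g)\<close> in dimension \<open>1 + d\<close>: coordinate \<open>None\<close> holds the cost \<open>j\<close>,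
  coordinate \<open>Some i\<close> the \<open>i\<close>-th entry of the gradient \<open>g\<close>.\<close>

definition value_grad :: "real \<Rightarrow> real ^ 'n \<Rightarrow> real ^ ('n option)" where
  "value_grad j g = (\<chi> k. case k of None \<Rightarrow> j | Some i \<Rightarrow> g $ i)"

definition observation ::
  "(real ^ 'n \<Rightarrow> 'w \<Rightarrow> real) \<Rightarrow> real ^ 'n \<Rightarrow> 'w \<Rightarrow> real ^ ('n option)" where
  "observation J w \<omega> = value_grad (J w \<omega>) (grad (\<lambda>v. J v \<omega>) w)"

definition mean_vector :: "'w measure \<Rightarrow> ('w \<Rightarrow> real ^ 'k) \<Rightarrow> real ^ 'k" where
  "mean_vector P X = (\<chi> k. LINT \<omega>|P. X \<omega> $ k)"

definition cross_covariance :: "'w measure \<Rightarrow> ('w \<Rightarrow> real) \<Rightarrow> ('w \<Rightarrow> real ^ 'k) \<Rightarrow> real ^ 'k" where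
  "cross_covariance P Y X = (\<chi> k. covariance P Y (\<lambda>\<omega>. X \<omega> $ k))"

definition covariance_matrix :: "'w measure \<Rightarrow> ('w \<Rightarrow> real ^ 'k) \<Rightarrow> real ^ 'k ^ 'k" where
  "covariance_matrix P X = (\<chi> k l. covariance P (\<lambda>\<omega>. X \<omega> $ k) (\<lambda>\<omega>. X \<omega> $ l))"

text \<open>The Gaussian conditioning formula for \<open>\<E>[J \<theta> | J w, \<nabla>J w]\<close>, as a function of the
  observed values \<open>(j, g)\<close> and for deterministic \<open>w\<close> and \<open>\<theta>\<close>.\<close>

definition taylor_approx ::
  "'w measure \<Rightarrow> (real ^ 'n \<Rightarrow> 'w \<Rightarrow> real) \<Rightarrow> real ^ 'n \<Rightarrow> real \<Rightarrow> real ^ 'n \<Rightarrow> real ^ 'n \<Rightarrow> real" where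
  "taylor_approx P J w j g \<theta> =
     (LINT \<omega>|P. J \<theta> \<omega>) +
     cross_covariance P (J \<theta>) (observation J w) \<bullet>
       (pseudo_inverse (covariance_matrix P (observation J w)) *v
         (value_grad j g - mean_vector P (observation J w)))"

definition rfd_step ::
  "'w measure \<Rightarrow> (real ^ 'n) set \<Rightarrow> (real ^ 'n \<Rightarrow> 'w \<Rightarrow> real) \<Rightarrow>
     real ^ 'n \<Rightarrow> real \<Rightarrow> real ^ 'n \<Rightarrow> real ^ 'n" where
  "rfd_step P N J w j g = arg_min_on (taylor_approx P J w j g) N"

primrec rfd ::
  "'w measure \<Rightarrow> (real ^ 'n) set \<Rightarrow> (real ^ 'n \<Rightarrow> 'w \<Rightarrow> real) \<Rightarrow> real ^ 'n \<Rightarrow>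
     nat \<Rightarrow> 'w \<Rightarrow> real ^ 'n" where
  "rfd P N J w0 0 \<omega> = w0"
| "rfd P N J w0 (Suc n) \<omega> =
     rfd_step P N J (rfd P N J w0 n \<omega>)
       (J (rfd P N J w0 n \<omega>) \<omega>) (grad (\<lambda>v. J v \<omega>) (rfd P N J w0 n \<omega>))"

text \<open>\<open>arg_min_on\<close> picks an arbitrary point if there is no minimizer; the following excludes
  this, and ties, along the iteration.\<close>

definition rfd_well_defined ::
  "'w measure \<Rightarrow> (real ^ 'n) set \<Rightarrow> (real ^ 'n \<Rightarrow> 'w \<Rightarrow> real) \<Rightarrow> real ^ 'n \<Rightarrow> bool" where
  "rfd_well_defined P N J w0 \<longleftrightarrow>
     (AE \<omega> in P. \<forall>n. \<exists>!\<theta>. is_arg_min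
        (taylor_approx P J (rfd P N J w0 n \<omega>)
           (J (rfd P N J w0 n \<omega>) \<omega>) (grad (\<lambda>v. J v \<omega>) (rfd P N J w0 n \<omega>)))
        (\<lambda>\<theta>. \<theta> \<in> N) \<theta>)"

end

theory Submission
  imports Defs
begin

text \<open>
  Let \<open>X(w)\<close> be the observation of value and gradient of \<open>J\<close> at \<open>w\<close>.  For the transformed cost
  \<open>v \<mapsto> a J(\<phi>(v)) + b\<close>, with \<open>\<phi>\<close> the identity in the first part and \<open>a = 1\<close>, \<open>b = 0\<close> in the
  second, the observation at \<open>v\<close> is an invertible affine image \<open>A X(w) + c\<close> of the one at
  \<open>w = \<phi>(v)\<close>, by the chain rule.  Observing \<open>X(w)\<close> or \<open>A X(w) + c\<close> gives the same information, so
  the new conditional expectation is the increasing affine image of the old one, and minimizers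
  correspond under \<open>\<phi>\<close>.  By induction the iterates correspond.

  The subtlety lies in the conditioning formula when the covariance matrix \<open>C(w)\<close> of \<open>X(w)\<close> is
  singular.  The formula with the pseudo-inverse is invariant under invertible affine maps at
  observed values \<open>x\<close> for which \<open>x - E[X(w)]\<close> lies in the range of \<open>C(w)\<close>, but not in general
  (\<open>gaussian_predictor_affine\<close>, which rests on \<open>inner_pseudo_inverse\<close>).  For a fixed \<open>w\<close> the
  observation almost surely has this property, but the iterates are random points, so it must
  hold almost surely for all \<open>w\<close> simultaneously.  This is \<open>AE_all_observations_supported\<close>,
  a separability argument that uses the continuity of \<open>w \<mapsto> X(w)\<close>.

  The covariances of the gradient are bilinear because the gradient is square integrable, which
  follows from the smoothness of the covariance function by Fatou's lemma
  (\<open>square_integrable_grad\<close>).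
\<close>

section \<open>Pseudo-inverses of symmetric matrices\<close>

lemma transpose_diff: "transpose (A - B) = transpose A - transpose (B :: real ^ 'n ^ 'm)"
  by (simp add: transpose_def vec_eq_iff)

lemma matrix_add_rdistrib: "(B + C) ** A = B ** A + (C :: real ^ 'n ^ 'm) ** A"
  by (simp add: matrix_matrix_mult_def vec_eq_iff sum.distrib algebra_simps)

lemma matrix_sub_ldistrib: "A ** (B - C) = A ** B - A ** (C :: real ^ 'n ^ 'm)"
  using matrix_add_ldistrib[of A "B - C" C] by simp

lemma matrix_sub_rdistrib: "(B - C) ** A = B ** A - (C :: real ^ 'n ^ 'm) ** A"
  using matrix_add_rdistrib[of "B - C" C A] by simp

lemma matrix_eq_zero_iff: "A = 0 \<longleftrightarrow> (\<forall>x. A *v x = 0)" for A :: "real ^ 'n ^ 'm"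
  by (metis matrix_eq matrix_vector_mult_0)

lemma inner_transpose_matrix: "x \<bullet> (A *v y) = (transpose A *v x) \<bullet> y"
  for A :: "real ^ 'n ^ 'm"
  by (simp add: dot_lmul_matrix)

lemma orthogonal_projection_matrix_exists:
  fixes S :: "(real ^ 'n) set"
  assumes "subspace S"
  obtains Q where "transpose Q = Q" "\<And>x. Q *v x \<in> S" "\<And>x. x \<in> S \<Longrightarrow> Q *v x = x"
proof -
  obtain B where B: "B \<subseteq> S" "pairwise orthogonal B" "\<And>x. x \<in> B \<Longrightarrow> norm x = 1"
      "independent B" "span B = S"
    using orthonormal_basis_subspace[OF assms] by metis
  have fin: "finite B" using B(4) independent_imp_finite by blast
  define f where "f x = (\<Sum>b\<in>B. (x \<bullet> b) *\<^sub>R b)" for x :: "real ^ 'n"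
  have lin: "linear f"
    unfolding f_def by (intro linear_compose_sum ballI) (auto intro!: linearI simp: inner_add_left scaleR_add_left)
  have f: "matrix f *v x = f x" for x by (simp add: lin matrix_works)
  have "transpose (matrix f) = matrix f"
  proof -
    have "(transpose (matrix f) *v x) \<bullet> y = (matrix f *v x) \<bullet> y" for x y
      unfolding inner_transpose_matrix[symmetric] f f_def
      by (simp add: inner_sum_left inner_sum_right mult_ac inner_commute)
    then show ?thesis by (metis matrix_eq vector_eq_rdot)
  qed
  moreover have "f x \<in> S" for x
    unfolding f_def using B assms by (auto intro!: subspace_sum subspace_scale)
  moreover have "f x = x" if "x \<in> S" for x
  proof -
    have fb: "f b = b" if b: "b \<in> B" for b
    proof -
      have "f b = (\<Sum>c\<in>B. if c = b then b else 0)"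
        unfolding f_def
        by (rule sum.cong) (use B(2,3) b in \<open>auto simp: pairwise_def orthogonal_def dot_square_norm\<close>)
      also have "\<dots> = b" using b fin by simp
      finally show ?thesis .
    qed
    have "x \<in> span B" using that B by simp
    then show ?thesis using linear_eq_on[OF lin linear_id, of x B] fb by simp
  qed
  ultimately show thesis using that f by metis
qed

lemma moore_penrose_unique:
  fixes A :: "real ^ 'n ^ 'm" and B C :: "real ^ 'm ^ 'n"
  assumes "A ** B ** A = A" "B ** A ** B = B" "transpose (A ** B) = A ** B" "transpose (B ** A) = B ** A"
    and "A ** C ** A = A" "C ** A ** C = C" "transpose (A ** C) = A ** C" "transpose (C ** A) = C ** A"
  shows "B = C"
proof -
  have AB: "A ** B = A ** C"
  proof -
    have "A ** B = transpose (A ** C ** A ** B)" using assms by simp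
    also have "\<dots> = transpose (A ** B) ** transpose (A ** C)"
      by (simp add: matrix_mul_assoc flip: matrix_transpose_mul)
    also have "\<dots> = A ** C" using assms by (simp add: matrix_mul_assoc)
    finally show ?thesis .
  qed
  have BA: "B ** A = C ** A"
  proof -
    have "B ** A = transpose (B ** (A ** C ** A))" using assms by simp
    also have "\<dots> = transpose (C ** A) ** transpose (B ** A)"
      by (simp add: matrix_mul_assoc flip: matrix_transpose_mul)
    also have "\<dots> = C ** (A ** B ** A)" by (simp only: assms(4,8)) (simp add: matrix_mul_assoc)
    finally show ?thesis using assms by simp
  qed
  have "B = B ** (A ** B)" using assms by (simp add: matrix_mul_assoc)
  also have "\<dots> = C ** A ** C" using AB BA by (simp add: matrix_mul_assoc)
  finally show ?thesis using assms by simp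
qed

text \<open>If \<open>Q\<close> is the orthogonal projection onto the kernel of \<open>D\<close>, then \<open>D + Q\<close> is invertible, since
\<open>D\<close> is injective on the orthogonal complement of its kernel and maps it to itself.  The
pseudo-inverse is \<open>(D + Q)\<^bsup>-1\<^esup> - Q\<close>, because \<open>(D + Q)\<^bsup>-1\<^esup>\<close> inverts \<open>D\<close> on that complement
and is the identity on the kernel.\<close>

lemma moore_penrose_exists_symmetric:
  fixes D :: "real ^ 'n ^ 'n"
  assumes sym: "transpose D = D"
  obtains B where "D ** B ** D = D" "B ** D ** B = B"
    "transpose (D ** B) = D ** B" "transpose (B ** D) = B ** D"
proof -
  have "subspace {x. D *v x = 0}"
    by (auto simp: subspace_def matrix_vector_right_distrib matrix_vector_mult_scaleR)
  then obtain Q where Q: "transpose Q = Q" "\<And>x. D *v (Q *v x) = 0" "\<And>x. D *v x = 0 \<Longrightarrow> Q *v x = x"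
    using orthogonal_projection_matrix_exists by (metis (mono_tags, lifting) mem_Collect_eq)
  have DQ: "D ** Q = 0" using Q(2) by (simp add: matrix_eq_zero_iff flip: matrix_vector_mul_assoc)
  have QD: "Q ** D = 0"
  proof -
    have "transpose (D ** Q) = 0" by (simp add: DQ transpose_def vec_eq_iff)
    then show ?thesis by (simp add: matrix_transpose_mul Q(1) sym)
  qed
  have QQ: "Q ** Q = Q" using Q(2,3) by (simp add: matrix_eq flip: matrix_vector_mul_assoc)
  have inj: "x = 0" if a: "D *v x + Q *v x = 0" for x
  proof -
    have "Q *v (D *v x + Q *v x) = Q *v x"
      by (simp add: matrix_vector_right_distrib matrix_vector_mul_assoc QD QQ)
    with a have "Q *v x = 0" by simp
    with a Q(3)[of x] show "x = 0" by simp
  qed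
  have "\<forall>x. (D + Q) *v x = 0 \<longrightarrow> x = 0"
    unfolding matrix_vector_mult_add_rdistrib using inj by blast
  then obtain T where T: "T ** (D + Q) = mat 1"
    using matrix_left_invertible_ker[of "D + Q"] by blast
  then have T': "(D + Q) ** T = mat 1" using matrix_left_right_inverse by blast
  have TQ: "T ** Q = Q"
  proof -
    have "T ** Q = T ** ((D + Q) ** Q)" by (simp add: matrix_add_rdistrib DQ QQ)
    also have "\<dots> = Q" by (simp add: matrix_mul_assoc T)
    finally show ?thesis .
  qed
  have QT: "Q ** T = Q"
  proof -
    have "Q ** T = (Q ** (D + Q)) ** T" by (simp add: matrix_add_ldistrib QD QQ)
    also have "\<dots> = Q" by (simp add: T' flip: matrix_mul_assoc)
    finally show ?thesis .
  qed
  have TD: "T ** D = mat 1 - Q" using T TQ by (simp add: matrix_add_ldistrib algebra_simps)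
  have DT: "D ** T = mat 1 - Q" using T' QT by (simp add: matrix_add_rdistrib algebra_simps)
  show thesis
  proof (rule that[of "T - Q"])
    have 1: "D ** (T - Q) = mat 1 - Q" by (simp add: matrix_sub_ldistrib DT DQ)
    have 2: "(T - Q) ** D = mat 1 - Q" by (simp add: matrix_sub_rdistrib TD QD)
    show "D ** (T - Q) ** D = D" by (simp add: 1 matrix_sub_rdistrib QD)
    show "(T - Q) ** D ** (T - Q) = T - Q"
      unfolding 2 by (simp add: matrix_sub_ldistrib matrix_sub_rdistrib QT QQ)
    show "transpose (D ** (T - Q)) = D ** (T - Q)" "transpose ((T - Q) ** D) = (T - Q) ** D"
      by (simp_all add: 1 2 transpose_diff Q(1))
  qed
qed

lemma pseudo_inverse_symmetric:
  fixes D :: "real ^ 'n ^ 'n"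
  assumes "transpose D = D"
  shows "D ** pseudo_inverse D ** D = D"
    and "transpose (D ** pseudo_inverse D) = D ** pseudo_inverse D"
proof -
  obtain B where B: "D ** B ** D = D" "B ** D ** B = B"
    "transpose (D ** B) = D ** B" "transpose (B ** D) = B ** D"
    using moore_penrose_exists_symmetric[OF assms] by blast
  have "pseudo_inverse D = B"
    unfolding pseudo_inverse_def
    by (rule the_equality) (use B moore_penrose_unique in blast)+
  with B show "D ** pseudo_inverse D ** D = D"
    "transpose (D ** pseudo_inverse D) = D ** pseudo_inverse D" by simp_all
qed

text \<open>The complement of the kernel of a symmetric matrix is its range, and \<open>D D\<^sup>+\<close> is the orthogonal
projection onto it.\<close>

lemma symmetric_range:
  fixes D :: "real ^ 'n ^ 'n"
  assumes sym: "transpose D = D" and y: "\<And>u. D *v u = 0 \<Longrightarrow> u \<bullet> y = 0"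
  shows "D *v (pseudo_inverse D *v y) = y"
proof -
  define E where "E = D ** pseudo_inverse D"
  have E: "transpose E = E" "E ** D = D"
    using pseudo_inverse_symmetric[OF sym] by (auto simp: E_def)
  have DE: "D ** E = D" using E sym by (metis matrix_transpose_mul)
  have EE: "E ** E = E" using E(2) by (metis E_def matrix_mul_assoc)
  define r where "r = y - E *v y"
  have "D *v r = 0" "E *v r = 0"
    by (simp_all add: r_def matrix_vector_mult_diff_distrib matrix_vector_mul_assoc DE EE)
  then have "r \<bullet> y = 0" "r \<bullet> (E *v y) = 0"
    using y inner_transpose_matrix[of r E y] E(1) by simp_all
  then have "r \<bullet> r = 0" by (simp add: r_def inner_diff_right inner_diff_left)
  then show ?thesis by (simp add: r_def E_def matrix_vector_mul_assoc)
qed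

text \<open>The pseudo-inverse does not commute with a change of basis: \<open>(A D A\<^sup>T)\<^sup>+\<close> is in general
different from \<open>A\<^bsup>-T\<^esup> D\<^sup>+ A\<^bsup>-1\<^esup>\<close>.  What does survive is the value of \<open>c \<bullet> D\<^sup>+ y\<close> for \<open>y\<close> in the
range of \<open>D\<close> and \<open>c\<close> orthogonal to its kernel: any solution \<open>z\<close> of \<open>D z = y\<close> can then replace
\<open>D\<^sup>+ y\<close>, since two solutions differ by an element of the kernel.\<close>

lemma inner_pseudo_inverse:
  fixes D :: "real ^ 'n ^ 'n"
  assumes sym: "transpose D = D" and z: "D *v z = y" and c: "\<And>u. D *v u = 0 \<Longrightarrow> c \<bullet> u = 0"
  shows "c \<bullet> (pseudo_inverse D *v y) = c \<bullet> z"
proof -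
  have "D *v (pseudo_inverse D *v y - z) = (D ** pseudo_inverse D ** D) *v z - y"
    by (simp add: matrix_vector_mult_diff_distrib z flip: matrix_vector_mul_assoc)
  also have "\<dots> = 0" using pseudo_inverse_symmetric[OF sym] z by simp
  finally have "c \<bullet> (pseudo_inverse D *v y - z) = 0" by (rule c)
  then show ?thesis by (simp add: inner_diff_right)
qed

section \<open>Gaussian conditioning under affine maps\<close>

definition square_integrable :: "'w measure \<Rightarrow> ('w \<Rightarrow> real) \<Rightarrow> bool" where
  "square_integrable P X \<longleftrightarrow> X \<in> borel_measurable P \<and> integrable P (\<lambda>\<omega>. (X \<omega>)\<^sup>2)"

lemma square_integrable_product:
  assumes "square_integrable P X" "square_integrable P Y"
  shows "integrable P (\<lambda>\<omega>. X \<omega> * Y \<omega>)"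
proof (rule Bochner_Integration.integrable_bound)
  show "integrable P (\<lambda>\<omega>. (X \<omega>)\<^sup>2 + (Y \<omega>)\<^sup>2)"
    using assms by (auto simp: square_integrable_def)
  show "(\<lambda>\<omega>. X \<omega> * Y \<omega>) \<in> borel_measurable P"
    using assms by (auto simp: square_integrable_def)
  have "\<bar>x * y\<bar> \<le> x\<^sup>2 + y\<^sup>2" for x y :: real
  proof -
    have "2 * (\<bar>x\<bar> * \<bar>y\<bar>) \<le> x\<^sup>2 + y\<^sup>2"
      using sum_squares_bound[of "\<bar>x\<bar>" "\<bar>y\<bar>"] by simp
    moreover have "0 \<le> \<bar>x\<bar> * \<bar>y\<bar>" by simp
    ultimately have "\<bar>x\<bar> * \<bar>y\<bar> \<le> x\<^sup>2 + y\<^sup>2" by linarith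
    then show ?thesis by (simp add: abs_mult)
  qed
  then show "AE \<omega> in P. norm (X \<omega> * Y \<omega>) \<le> norm ((X \<omega>)\<^sup>2 + (Y \<omega>)\<^sup>2)"
    by (auto intro!: AE_I2)
qed

lemma square_integrable_add:
  assumes "square_integrable P X" "square_integrable P Y"
  shows "square_integrable P (\<lambda>\<omega>. X \<omega> + Y \<omega>)"
  using assms square_integrable_product[OF assms]
  by (auto simp: square_integrable_def power2_sum mult.assoc)

lemma square_integrable_cmult:
  assumes "square_integrable P X"
  shows "square_integrable P (\<lambda>\<omega>. c * X \<omega>)"
  using assms by (auto simp: square_integrable_def power_mult_distrib)

lemma covariance_commute: "covariance P X Y = covariance P Y X"
  by (simp add: covariance_def mult.commute)

lemma covariance_cong:
  assumes "\<And>\<omega>. \<omega> \<in> space P \<Longrightarrow> X \<omega> = X' \<omega>" "\<And>\<omega>. \<omega> \<in> space P \<Longrightarrow> Y \<omega> = Y' \<omega>"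
  shows "covariance P X Y = covariance P X' Y'"
  unfolding covariance_def
  using assms by (simp cong: Bochner_Integration.integral_cong)

context prob_space
begin

lemma square_integrable_const: "square_integrable M (\<lambda>\<omega>. c)"
  by (simp add: square_integrable_def)

lemma square_integrable_integrable: "square_integrable M X \<Longrightarrow> integrable M X"
  unfolding square_integrable_def by (blast intro: square_integrable_imp_integrable)

lemma square_integrable_sum:
  assumes "\<And>k. k \<in> A \<Longrightarrow> square_integrable M (X k)"
  shows "square_integrable M (\<lambda>\<omega>. \<Sum>k\<in>A. X k \<omega>)"
  using assms
  by (induction A rule: infinite_finite_induct) (auto intro: square_integrable_add square_integrable_const)

lemma covariance_affine_left:
  assumes "square_integrable M X"
  shows "covariance M (\<lambda>\<omega>. a * X \<omega> + b) Y = a * covariance M X Y"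
proof -
  have "(LINT \<omega>|M. a * X \<omega> + b) = a * (LINT \<omega>|M. X \<omega>) + b"
    using square_integrable_integrable[OF assms] by (simp add: prob_space)
  then show ?thesis
    by (simp add: covariance_def mult.assoc flip: right_diff_distrib)
qed

lemma covariance_affine_right:
  assumes "square_integrable M Y"
  shows "covariance M X (\<lambda>\<omega>. a * Y \<omega> + b) = a * covariance M X Y"
  using covariance_affine_left[OF assms, of a b X] by (simp add: covariance_commute)

lemma covariance_sum_left:
  assumes X: "\<And>k. k \<in> A \<Longrightarrow> square_integrable M (X k)" and Y: "square_integrable M Y"
  shows "covariance M (\<lambda>\<omega>. \<Sum>k\<in>A. c k * X k \<omega>) Y = (\<Sum>k\<in>A. c k * covariance M (X k) Y)"
proof -
  let ?m = "\<lambda>X. LINT \<omega>|M. X \<omega>"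
  have int: "integrable M (\<lambda>\<omega>. (X k \<omega> - ?m (X k)) * (Y \<omega> - ?m Y))" if "k \<in> A" for k
    using square_integrable_product square_integrable_add[OF _ square_integrable_const[of "- ?m (X k)"]]
      square_integrable_add[OF _ square_integrable_const[of "- ?m Y"]] X[OF that] Y by fastforce
  have "?m (\<lambda>\<omega>. \<Sum>k\<in>A. c k * X k \<omega>) = (\<Sum>k\<in>A. c k * ?m (X k))"
    using X by (subst Bochner_Integration.integral_sum) (auto intro: square_integrable_integrable)
  then have "covariance M (\<lambda>\<omega>. \<Sum>k\<in>A. c k * X k \<omega>) Y =
      (LINT \<omega>|M. (\<Sum>k\<in>A. c k * ((X k \<omega> - ?m (X k)) * (Y \<omega> - ?m Y))))"
    by (simp add: covariance_def sum_distrib_right sum_distrib_left algebra_simps flip: sum_subtractf)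
  also have "\<dots> = (\<Sum>k\<in>A. c k * covariance M (X k) Y)"
    using int by (subst Bochner_Integration.integral_sum) (auto simp: covariance_def)
  finally show ?thesis .
qed

lemma AE_const_imp_covariance_zero:
  assumes "AE \<omega> in M. X \<omega> = (LINT \<omega>'|M. X \<omega>')"
  shows "covariance M Y X = 0"
  unfolding covariance_def using assms by (intro integral_eq_zero_AE) auto

lemma covariance_self_zero_imp_AE_const:
  assumes "square_integrable M X" "covariance M X X = 0"
  shows "AE \<omega> in M. X \<omega> = (LINT \<omega>'|M. X \<omega>')"
proof -
  let ?Z = "\<lambda>\<omega>. X \<omega> - (LINT \<omega>'|M. X \<omega>')"
  have "square_integrable M ?Z"
    using square_integrable_add[OF assms(1) square_integrable_const[of "- (LINT \<omega>'|M. X \<omega>')"]] by simp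
  then have "integrable M (\<lambda>\<omega>. (?Z \<omega>)\<^sup>2)" by (simp add: square_integrable_def)
  moreover have "(LINT \<omega>|M. (?Z \<omega>)\<^sup>2) = 0"
    using assms(2) by (simp add: covariance_def power2_eq_square)
  ultimately have "AE \<omega> in M. (?Z \<omega>)\<^sup>2 = 0"
    by (subst (asm) integral_nonneg_eq_0_iff_AE) auto
  then show ?thesis by auto
qed

end

definition square_integrable_vector :: "'w measure \<Rightarrow> ('w \<Rightarrow> real ^ 'k) \<Rightarrow> bool" where
  "square_integrable_vector P X \<longleftrightarrow> (\<forall>k. square_integrable P (\<lambda>\<omega>. X \<omega> $ k))"

context prob_space
begin

lemma square_integrable_inner:
  assumes "square_integrable_vector M X"
  shows "square_integrable M (\<lambda>\<omega>. u \<bullet> X \<omega>)"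
  using assms unfolding inner_vec_def inner_real_def square_integrable_vector_def
  by (intro square_integrable_sum square_integrable_cmult) auto

lemma inner_mean_vector:
  assumes "square_integrable_vector M X"
  shows "u \<bullet> mean_vector M X = (LINT \<omega>|M. u \<bullet> X \<omega>)"
  using assms unfolding inner_vec_def inner_real_def square_integrable_vector_def mean_vector_def
  by (subst Bochner_Integration.integral_sum) (auto intro: square_integrable_integrable)

lemma inner_cross_covariance:
  assumes "square_integrable_vector M X" "square_integrable M Y"
  shows "u \<bullet> cross_covariance M Y X = covariance M (\<lambda>\<omega>. u \<bullet> X \<omega>) Y"
  using assms unfolding inner_vec_def inner_real_def square_integrable_vector_def cross_covariance_def
  by (subst covariance_sum_left) (auto simp: covariance_commute)

lemma inner_covariance_matrix:
  assumes X: "square_integrable_vector M X"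
  shows "u \<bullet> (covariance_matrix M X *v v) = covariance M (\<lambda>\<omega>. u \<bullet> X \<omega>) (\<lambda>\<omega>. v \<bullet> X \<omega>)"
proof -
  have "covariance_matrix M X *v v = cross_covariance M (\<lambda>\<omega>. v \<bullet> X \<omega>) X"
  proof -
    have "(covariance_matrix M X *v v) $ k = covariance M (\<lambda>\<omega>. v \<bullet> X \<omega>) (\<lambda>\<omega>. X \<omega> $ k)" for k
      using X unfolding inner_vec_def inner_real_def square_integrable_vector_def
      by (subst covariance_sum_left)
         (auto simp: matrix_vector_mult_def covariance_matrix_def covariance_commute mult.commute intro!: sum.cong)
    then show ?thesis by (simp add: vec_eq_iff cross_covariance_def)
  qed
  then show ?thesis using inner_cross_covariance[OF X square_integrable_inner[OF X]] by simp
qed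

lemma transpose_covariance_matrix: "transpose (covariance_matrix M X) = covariance_matrix M X"
  by (simp add: transpose_def covariance_matrix_def vec_eq_iff covariance_commute)

text \<open>\<open>u \<bullet> C u\<close> is the variance of \<open>u \<bullet> X\<close>, so the directions in the kernel of \<open>C\<close> are those in
which \<open>X\<close> is almost surely constant.\<close>

lemma covariance_matrix_kernel_AE:
  assumes X: "square_integrable_vector M X" and u: "covariance_matrix M X *v u = 0"
  shows "AE \<omega> in M. u \<bullet> X \<omega> = u \<bullet> mean_vector M X"
  using covariance_self_zero_imp_AE_const[OF square_integrable_inner[OF X, of u]]
    inner_covariance_matrix[OF X, of u u] u by (simp add: inner_mean_vector[OF X])

lemma cross_covariance_orthogonal_kernel:
  assumes X: "square_integrable_vector M X" and Y: "square_integrable M Y"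
    and u: "covariance_matrix M X *v u = 0"
  shows "cross_covariance M Y X \<bullet> u = 0"
  using covariance_matrix_kernel_AE[OF X u] AE_const_imp_covariance_zero[of "\<lambda>\<omega>. u \<bullet> X \<omega>" Y]
  by (simp add: inner_cross_covariance[OF X Y] inner_mean_vector[OF X] inner_commute[of _ u] covariance_commute)

end

definition gaussian_predictor :: "'w measure \<Rightarrow> ('w \<Rightarrow> real) \<Rightarrow> ('w \<Rightarrow> real ^ 'k) \<Rightarrow> real ^ 'k \<Rightarrow> real" where
  "gaussian_predictor P Y X x = (LINT \<omega>|P. Y \<omega>) +
     cross_covariance P Y X \<bullet> (pseudo_inverse (covariance_matrix P X) *v (x - mean_vector P X))"

lemma taylor_approx_gaussian_predictor:
  "taylor_approx P J w j g \<theta> = gaussian_predictor P (J \<theta>) (observation J w) (value_grad j g)"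
  by (simp add: taylor_approx_def gaussian_predictor_def)

lemma gaussian_predictor_cong:
  assumes "\<And>\<omega>. \<omega> \<in> space P \<Longrightarrow> X \<omega> = X' \<omega>" "\<And>\<omega>. \<omega> \<in> space P \<Longrightarrow> Y \<omega> = Y' \<omega>"
  shows "gaussian_predictor P Y X x = gaussian_predictor P Y' X' x"
proof -
  have "mean_vector P X = mean_vector P X'"
    using assms by (simp add: mean_vector_def cong: Bochner_Integration.integral_cong)
  moreover have "cross_covariance P Y X = cross_covariance P Y' X'"
    unfolding cross_covariance_def using assms by (simp cong: covariance_cong)
  moreover have "covariance_matrix P X = covariance_matrix P X'"
    unfolding covariance_matrix_def using assms by (simp cong: covariance_cong)
  moreover have "(LINT \<omega>|P. Y \<omega>) = (LINT \<omega>|P. Y' \<omega>)"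
    using assms by (simp cong: Bochner_Integration.integral_cong)
  ultimately show ?thesis by (simp add: gaussian_predictor_def)
qed

text \<open>By the symmetry of the covariance matrix this says that \<open>x - E[X]\<close> lies in its range.  It is
phrased through the kernel because each kernel vector contributes one scalar equation, which
holds almost surely for \<open>x = X\<close> and is stable under limits.\<close>

definition in_affine_support :: "'w measure \<Rightarrow> ('w \<Rightarrow> real ^ 'k) \<Rightarrow> real ^ 'k \<Rightarrow> bool" where
  "in_affine_support P X x \<longleftrightarrow>
     (\<forall>u. covariance_matrix P X *v u = 0 \<longrightarrow> u \<bullet> x = u \<bullet> mean_vector P X)"

text \<open>With \<open>C\<close>, \<open>m\<close> the covariance matrix and mean of \<open>X\<close>, the transformed observation has covariance
matrix \<open>A C A\<^sup>T\<close>, and if \<open>C z = x - m\<close> then \<open>A\<^bsup>-T\<^esup> z\<close> solves the transformed equation.  By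
\<open>inner_pseudo_inverse\<close> this solution may be used in place of the one given by the
pseudo-inverse, and its inner product with the transformed cross covariance \<open>a A k\<close> is
\<open>a (k \<bullet> z)\<close>.  At points \<open>x\<close> outside the affine support the identity can fail.\<close>

lemma (in prob_space) gaussian_predictor_affine:
  fixes A :: "real ^ 'k ^ 'k"
  assumes X: "square_integrable_vector M X" and Y: "square_integrable M Y"
    and A: "invertible A" and x: "in_affine_support M X x"
  shows "gaussian_predictor M (\<lambda>\<omega>. a * Y \<omega> + b) (\<lambda>\<omega>. A *v X \<omega> + c) (A *v x + c) =
     a * gaussian_predictor M Y X x + b"
proof -
  let ?C = "covariance_matrix M X" and ?m = "mean_vector M X" and ?k = "cross_covariance M Y X"
  define X' where "X' = (\<lambda>\<omega>. A *v X \<omega> + c)"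
  define Y' where "Y' = (\<lambda>\<omega>. a * Y \<omega> + b)"
  let ?C' = "covariance_matrix M X'" and ?m' = "mean_vector M X'" and ?k' = "cross_covariance M Y' X'"
  \<comment> \<open>The factor 1 puts the term into the form of the affine rules for covariances.\<close>
  have uX': "u \<bullet> X' \<omega> = 1 * ((transpose A *v u) \<bullet> X \<omega>) + u \<bullet> c" for u \<omega>
    by (simp add: X'_def inner_add_right inner_transpose_matrix)
  have Y': "square_integrable M Y'"
    unfolding Y'_def by (intro square_integrable_add square_integrable_cmult square_integrable_const Y)
  have "square_integrable M (\<lambda>\<omega>. u \<bullet> X' \<omega>)" for u
    unfolding uX' by (intro square_integrable_add square_integrable_cmult square_integrable_const
        square_integrable_inner X)
  from this[of "axis _ 1"] have X': "square_integrable_vector M X'"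
    by (simp add: square_integrable_vector_def inner_axis' )
  have m': "?m' = A *v ?m + c"
  proof (subst vector_eq_rdot[symmetric], intro allI)
    fix u
    show "?m' \<bullet> u = (A *v ?m + c) \<bullet> u"
      unfolding inner_commute[of _ u] inner_mean_vector[OF X'] uX' inner_add_right
        inner_transpose_matrix[of u A] inner_mean_vector[OF X]
      using square_integrable_integrable[OF square_integrable_inner[OF X]] by (simp add: prob_space)
  qed
  have k': "?k' = a *\<^sub>R (A *v ?k)"
  proof (subst vector_eq_rdot[symmetric], intro allI)
    fix u
    show "?k' \<bullet> u = (a *\<^sub>R (A *v ?k)) \<bullet> u"
      unfolding inner_commute[of _ u] inner_cross_covariance[OF X' Y'] uX' inner_scaleR_right
        inner_transpose_matrix[of u A] inner_cross_covariance[OF X Y]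
      unfolding covariance_affine_left[OF square_integrable_inner[OF X]] Y'_def
        covariance_affine_right[OF Y] by simp
  qed
  have C': "?C' = A ** ?C ** transpose A"
  proof -
    have "u \<bullet> (?C' *v v) = u \<bullet> ((A ** ?C ** transpose A) *v v)" for u v
      unfolding matrix_vector_mul_assoc[symmetric] inner_transpose_matrix[of u A]
        inner_covariance_matrix[OF X'] inner_covariance_matrix[OF X] uX'
        covariance_affine_left[OF square_integrable_inner[OF X]]
        covariance_affine_right[OF square_integrable_inner[OF X]] by simp
    then show ?thesis by (metis matrix_eq vector_eq_ldot)
  qed
  obtain B where B: "A ** B = mat 1" "B ** A = mat 1" using A by (auto simp: invertible_def)
  define z where "z = pseudo_inverse ?C *v (x - ?m)"
  have z: "?C *v z = x - ?m"
    unfolding z_def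
    by (rule symmetric_range[OF transpose_covariance_matrix])
       (use x in \<open>auto simp: in_affine_support_def inner_diff_right\<close>)
  have z': "?C' *v (transpose B *v z) = (A *v x + c) - ?m'"
  proof -
    have "transpose A ** transpose B = mat 1"
      by (metis B(2) matrix_transpose_mul transpose_mat)
    then have "?C' *v (transpose B *v z) = A *v (?C *v z)"
      by (metis C' matrix_mul_assoc matrix_mul_rid matrix_vector_mul_assoc)
    then show ?thesis by (simp add: z m' matrix_vector_mult_diff_distrib)
  qed
  have "?k' \<bullet> (pseudo_inverse ?C' *v ((A *v x + c) - ?m')) = ?k' \<bullet> (transpose B *v z)"
    by (rule inner_pseudo_inverse[OF transpose_covariance_matrix z'])
       (rule cross_covariance_orthogonal_kernel[OF X' Y'])
  also have "\<dots> = a * (?k \<bullet> z)"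
  proof -
    have "(transpose B *v z) \<bullet> (A *v ?k) = z \<bullet> ?k"
      unfolding inner_transpose_matrix[symmetric] matrix_vector_mul_assoc B by simp
    then show ?thesis unfolding k' by (metis inner_commute inner_scaleR_left)
  qed
  finally have "?k' \<bullet> (pseudo_inverse ?C' *v ((A *v x + c) - ?m')) = a * (?k \<bullet> z)" .
  moreover have "(LINT \<omega>|M. Y' \<omega>) = a * (LINT \<omega>|M. Y \<omega>) + b"
    using square_integrable_integrable[OF Y] by (simp add: Y'_def prob_space)
  ultimately have "gaussian_predictor M Y' X' (A *v x + c) = a * gaussian_predictor M Y X x + b"
    unfolding gaussian_predictor_def z_def by (simp add: distrib_left)
  then show ?thesis unfolding X'_def Y'_def .
qed

section \<open>Gradients and increments of smooth covariances\<close>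

lemma GDERIV_grad:
  fixes f :: "real ^ 'n \<Rightarrow> real"
  assumes "GDERIV f x :> D"
  shows "grad f x = D"
  unfolding grad_def
proof (rule the_equality)
  show "GDERIV f x :> D" by (rule assms)
next
  fix E assume "GDERIV f x :> E"
  then have "(\<lambda>h. h \<bullet> E) = (\<lambda>h. h \<bullet> D)"
    using assms unfolding gderiv_def by (rule has_derivative_unique)
  then have "\<forall>h. h \<bullet> E = h \<bullet> D" by (simp add: fun_eq_iff)
  then show "E = D" by (simp only: vector_eq_ldot)
qed

lemma differentiable_has_derivative_grad:
  fixes f :: "real ^ 'n \<Rightarrow> real"
  assumes "f differentiable (at x)"
  shows "(f has_derivative (\<lambda>h. h \<bullet> grad f x)) (at x)"
proof -
  from assms obtain f' where f': "(f has_derivative f') (at x)"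
    by (auto simp: differentiable_def)
  then have lin: "linear f'" by (rule has_derivative_linear)
  have "f' = (\<lambda>h. h \<bullet> adjoint f' 1)"
    by (rule ext) (use adjoint_works[OF lin, of _ 1] in simp)
  with f' have "GDERIV f x :> adjoint f' 1" by (simp add: gderiv_def)
  from GDERIV_grad[OF this] this show ?thesis by (simp add: gderiv_def)
qed

lemma grad_affine:
  fixes f :: "real ^ 'n \<Rightarrow> real"
  assumes "f differentiable (at x)"
  shows "grad (\<lambda>v. a * f v + b) x = a *\<^sub>R grad f x"
proof (rule GDERIV_grad, unfold gderiv_def)
  show "((\<lambda>v. a * f v + b) has_derivative (\<lambda>h. h \<bullet> a *\<^sub>R grad f x)) (at x)"
    by (rule has_derivative_eq_rhs, rule derivative_intros differentiable_has_derivative_grad[OF assms])+ auto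
qed

lemma grad_compose:
  fixes f :: "real ^ 'n \<Rightarrow> real" and \<phi> :: "real ^ 'm \<Rightarrow> real ^ 'n"
  assumes "f differentiable (at (\<phi> v))" "\<phi> differentiable (at v)"
  shows "grad (\<lambda>v. f (\<phi> v)) v = transpose (jacobian \<phi> (at v)) *v grad f (\<phi> v)"
proof (rule GDERIV_grad, unfold gderiv_def)
  have "(\<phi> has_derivative (\<lambda>h. jacobian \<phi> (at v) *v h)) (at v)"
    using assms(2) jacobian_works by blast
  from has_derivative_compose[OF this differentiable_has_derivative_grad[OF assms(1)]]
  have "((\<lambda>x. f (\<phi> x)) has_derivative (\<lambda>h. (jacobian \<phi> (at v) *v h) \<bullet> grad f (\<phi> v))) (at v)" .
  moreover have "(jacobian \<phi> (at v) *v h) \<bullet> y = h \<bullet> (transpose (jacobian \<phi> (at v)) *v y)" for h y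
    using inner_transpose_matrix[of y "jacobian \<phi> (at v)" h] by (simp only: inner_commute)
  ultimately show "((\<lambda>v. f (\<phi> v)) has_derivative
      (\<lambda>h. h \<bullet> (transpose (jacobian \<phi> (at v)) *v grad f (\<phi> v)))) (at v)" by (simp only:)
qed

lemma has_real_derivative_along_axis:
  fixes f :: "real ^ 'n \<Rightarrow> real"
  assumes "f differentiable (at (x + t *\<^sub>R axis i 1))"
  shows "((\<lambda>r. f (x + r *\<^sub>R axis i 1)) has_real_derivative grad f (x + t *\<^sub>R axis i 1) $ i) (at t)"
proof -
  have "((\<lambda>r. x + r *\<^sub>R axis i 1) has_derivative (\<lambda>h. h *\<^sub>R axis i 1)) (at t)"
    by (auto intro!: derivative_eq_intros)
  from has_derivative_compose[OF this differentiable_has_derivative_grad[OF assms]]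
  show ?thesis by (simp add: has_field_derivative_def inner_axis' mult.commute[of _ "grad _ _ $ i"])
qed

lemma mvt_along_axis:
  fixes f :: "real ^ 'n \<Rightarrow> real"
  assumes "0 < h" and "\<And>r. 0 \<le> r \<Longrightarrow> r \<le> h \<Longrightarrow> f differentiable (at (x + r *\<^sub>R axis i 1))"
  obtains r where "0 < r" "r < h" "f (x + h *\<^sub>R axis i 1) - f x = h * (grad f (x + r *\<^sub>R axis i 1) $ i)"
proof -
  have "\<exists>z>0. z < h \<and> f (x + h *\<^sub>R axis i 1) - f (x + 0 *\<^sub>R axis i 1) = (h - 0) * (grad f (x + z *\<^sub>R axis i 1) $ i)"
    by (rule MVT2[OF assms(1)]) (use has_real_derivative_along_axis assms(2) in blast)
  then show thesis using that by auto
qed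

lemma difference_quotient_tendsto_grad:
  fixes f :: "real ^ 'n \<Rightarrow> real"
  assumes "f differentiable (at x)" and "h \<longlonglongrightarrow> 0" "\<And>n. h n \<noteq> 0"
  shows "(\<lambda>n. (f (x + h n *\<^sub>R axis i 1) - f x) / h n) \<longlonglongrightarrow> grad f x $ i"
proof -
  have "((\<lambda>r. f (x + r *\<^sub>R axis i 1)) has_real_derivative grad f x $ i) (at 0)"
    using has_real_derivative_along_axis[of f x 0 i] assms(1) by simp
  then have "((\<lambda>r. (f (x + r *\<^sub>R axis i 1) - f x) / r) \<longlongrightarrow> grad f x $ i) (at 0)"
    by (simp add: has_field_derivative_iff)
  moreover have "filterlim h (at 0) sequentially"
    using assms(2,3) by (simp add: filterlim_at)
  ultimately show ?thesis by (rule filterlim_compose)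
qed

text \<open>The left side is the variance of \<open>J t - J s\<close> if \<open>K\<close> is the covariance function of \<open>J\<close>.  Applying
the mean value theorem once in each argument turns this double increment into \<open>h\<^sup>2\<close> times a
mixed second derivative of \<open>K\<close> near \<open>(s, s)\<close>, where that derivative is bounded by continuity.\<close>

lemma smooth_covariance_increment_bound:
  fixes K :: "real ^ 'n \<Rightarrow> real ^ 'n \<Rightarrow> real"
  assumes K: "smooth_covariance_on K N" and N: "open N" and s: "s \<in> N"
  obtains d C where "0 < d" "ball s d \<subseteq> N" 
    "\<And>h. 0 < h \<Longrightarrow> h < d \<Longrightarrow> (let t = s + h *\<^sub>R axis i 1 in
        (K t t - K s t) - (K t s - K s s)) \<le> C * h\<^sup>2"
proof -
  define H where "H x y = grad (\<lambda>t'. grad (\<lambda>s'. K s' t') x $ i) y" for x y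
  have K1: "\<And>x y. x \<in> N \<Longrightarrow> y \<in> N \<Longrightarrow> (\<lambda>s'. K s' y) differentiable (at x)"
    and K2: "\<And>x y. x \<in> N \<Longrightarrow> y \<in> N \<Longrightarrow> (\<lambda>t'. grad (\<lambda>s'. K s' t') x $ i) differentiable (at y)"
    and K3: "continuous_on (N \<times> N) (\<lambda>(x, y). H x y)"
    using K unfolding smooth_covariance_on_def H_def by blast+
  obtain d1 where d1: "d1 > 0"
    "\<And>p. p \<in> N \<times> N \<Longrightarrow> dist p (s, s) < d1 \<Longrightarrow> dist ((\<lambda>(x, y). H x y) p) (H s s) < 1"
    using K3[unfolded continuous_on_iff, rule_format, of "(s, s)" 1] s by (auto simp del: split_paired_All)
  have near: "dist (H x y) (H s s) < 1" if "x \<in> N" "y \<in> N" "dist x s + dist y s < d1" for x y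
  proof -
    have "dist (x, y) (s, s) \<le> dist x s + dist y s"
      by (simp add: dist_Pair_Pair sqrt_sum_squares_le_sum)
    then show ?thesis using d1(2)[of "(x, y)"] that by simp
  qed
  obtain d2 where d2: "d2 > 0" "ball s d2 \<subseteq> N" using N s openE by blast
  define d where "d = min d2 (d1 / 2)"
  have d: "d > 0" "ball s d \<subseteq> N" using d1 d2 by (auto simp: d_def)
  have inN: "s + r *\<^sub>R axis i 1 \<in> N" "dist (s + r *\<^sub>R axis i 1) s < d1 / 2" if "0 \<le> r" "r < d" for r
  proof -
    have "dist (s + r *\<^sub>R axis i 1) s = r" using that by (simp add: dist_norm)
    then show "dist (s + r *\<^sub>R axis i 1) s < d1 / 2" "s + r *\<^sub>R axis i 1 \<in> N"
      using that d(2) by (auto simp: d_def dist_commute)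
  qed
  have sN: "s \<in> N" by fact
  show thesis
  proof (rule that[OF d, of "norm (H s s) + 1"])
    fix h assume h: "0 < h" "h < d"
    define t where "t = s + h *\<^sub>R axis i 1"
    have tN: "t \<in> N" using inN[of h] h by (simp add: t_def)
    define F where "F x = 1 * K x t + (- 1) * K x s" for x
    have dF: "F differentiable (at x)" if "x \<in> N" for x
      unfolding F_def using K1[OF that] tN sN by (intro derivative_intros) auto
    have gF: "grad F x $ i = grad (\<lambda>s'. K s' t) x $ i - grad (\<lambda>s'. K s' s) x $ i" if "x \<in> N" for x
    proof -
      have "GDERIV F x :> grad (\<lambda>s'. K s' t) x - grad (\<lambda>s'. K s' s) x"
        unfolding F_def
        using GDERIV_diff[of "\<lambda>x. K x t" x "grad (\<lambda>s'. K s' t) x" "\<lambda>x. K x s" "grad (\<lambda>s'. K s' s) x"]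
          differentiable_has_derivative_grad[OF K1[OF that tN]]
          differentiable_has_derivative_grad[OF K1[OF that sN]] by (simp add: gderiv_def)
      from GDERIV_grad[OF this] show ?thesis by simp
    qed
    obtain r where r: "0 < r" "r < h" "F t - F s = h * (grad F (s + r *\<^sub>R axis i 1) $ i)"
    proof (rule mvt_along_axis[of h F s i])
      show "F differentiable (at (s + r *\<^sub>R axis i 1))" if "0 \<le> r" "r \<le> h" for r
        using that h by (intro dF inN(1)) auto
    qed (use h in \<open>auto simp: t_def\<close>)
    define x where "x = s + r *\<^sub>R axis i 1"
    have xN: "x \<in> N" "dist x s < d1 / 2" using inN[of r] r h by (auto simp: x_def)
    obtain q where q: "0 < q" "q < h"
      "grad (\<lambda>s'. K s' t) x $ i - grad (\<lambda>s'. K s' s) x $ i = h * (H x (s + q *\<^sub>R axis i 1) $ i)"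
    proof (rule mvt_along_axis[of h "\<lambda>t'. grad (\<lambda>s'. K s' t') x $ i" s i])
      show "(\<lambda>t'. grad (\<lambda>s'. K s' t') x $ i) differentiable (at (s + r *\<^sub>R axis i 1))"
        if "0 \<le> r" "r \<le> h" for r
        using that h by (intro K2[OF xN(1)] inN(1)) auto
    qed (use h in \<open>auto simp: t_def H_def\<close>)
    define y where "y = s + q *\<^sub>R axis i 1"
    have yN: "y \<in> N" "dist y s < d1 / 2" using inN[of q] q h by (auto simp: y_def)
    have "H x y $ i \<le> norm (H x y)" using component_le_norm_cart[of "H x y" i] by linarith
    also have "\<dots> \<le> norm (H s s) + dist (H x y) (H s s)"
      using norm_triangle_sub[of "H x y" "H s s"] by (simp add: dist_norm)
    also have "\<dots> \<le> norm (H s s) + 1" using near[OF xN(1) yN(1)] xN(2) yN(2) by simp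
    finally have "h\<^sup>2 * (H x y $ i) \<le> h\<^sup>2 * (norm (H s s) + 1)" by (intro mult_left_mono) auto
    moreover have "F t - F s = h\<^sup>2 * (H x y $ i)"
      using r(3) q(3) gF[OF xN(1)] by (simp add: x_def y_def power2_eq_square)
    ultimately show "(let t = s + h *\<^sub>R axis i 1 in (K t t - K s t) - (K t s - K s s)) \<le> (norm (H s s) + 1) * h\<^sup>2"
      by (simp add: F_def Let_def mult.commute flip: t_def)
  qed
qed

section \<open>Observations of a random cost function\<close>

lemma (in prob_space) gaussian_rv_square_integrable:
  assumes "gaussian_rv M Y"
  shows "square_integrable M Y"
proof -
  have Y: "Y \<in> borel_measurable M" using assms by (simp add: gaussian_rv_def)
  consider (normal) \<mu> \<sigma> where "\<sigma> > 0" "distributed M lborel Y (normal_density \<mu> \<sigma>)"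
    | (const) \<mu> where "AE \<omega> in M. Y \<omega> = \<mu>"
    using assms by (auto simp: gaussian_rv_def)
  then have "integrable M (\<lambda>\<omega>. (Y \<omega>)\<^sup>2)"
  proof cases
    case normal
    have "integrable lborel (\<lambda>y. normal_density \<mu> \<sigma> y * (y - \<mu>)\<^sup>2
        + 2 * \<mu> * (normal_density \<mu> \<sigma> y * y) - \<mu>\<^sup>2 * normal_density \<mu> \<sigma> y)"
      using normal(1) by (intro Bochner_Integration.integrable_add Bochner_Integration.integrable_diff integrable_mult_right
        integrable_normal_moment integrable_normal_moment_nz_1 integrable_normal_density)
    then have "integrable lborel (\<lambda>y. normal_density \<mu> \<sigma> y * y\<^sup>2)"
      by (rule Bochner_Integration.integrable_cong[OF refl, THEN iffD1, rotated])
         (simp add: power2_eq_square algebra_simps)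
    then show ?thesis
      using distributed_integrable[OF normal(2), of "\<lambda>y. y\<^sup>2"] by simp
  next
    case const
    have "integrable M (\<lambda>\<omega>. \<mu>\<^sup>2)" by simp
    then show ?thesis
      by (rule integrable_cong_AE_imp) (use Y const in auto)
  qed
  with Y show ?thesis by (simp add: square_integrable_def)
qed

text \<open>Fatou's lemma.\<close>

lemma (in prob_space) square_integrable_limit:
  assumes X: "\<And>n. square_integrable M (X n)"
    and lim: "\<And>\<omega>. \<omega> \<in> space M \<Longrightarrow> (\<lambda>n. X n \<omega>) \<longlonglongrightarrow> Y \<omega>"
    and bound: "\<And>n. (LINT \<omega>|M. (X n \<omega>)\<^sup>2) \<le> C"
  shows "square_integrable M Y"
proof -
  have X_meas[measurable]: "X n \<in> borel_measurable M" for n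
    using X by (simp add: square_integrable_def)
  have Y_meas: "Y \<in> borel_measurable M"
    by (rule borel_measurable_LIMSEQ_real[OF lim]) auto
  have "(\<integral>\<^sup>+ \<omega>. ennreal ((Y \<omega>)\<^sup>2) \<partial>M) = (\<integral>\<^sup>+ \<omega>. liminf (\<lambda>n. ennreal ((X n \<omega>)\<^sup>2)) \<partial>M)"
  proof (rule nn_integral_cong)
    fix \<omega> assume "\<omega> \<in> space M"
    then have "(\<lambda>n. ennreal ((X n \<omega>)\<^sup>2)) \<longlonglongrightarrow> ennreal ((Y \<omega>)\<^sup>2)"
      by (intro tendsto_ennrealI tendsto_power lim)
    then show "ennreal ((Y \<omega>)\<^sup>2) = liminf (\<lambda>n. ennreal ((X n \<omega>)\<^sup>2))"
      by (rule lim_imp_Liminf[OF trivial_limit_sequentially, symmetric])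
  qed
  also have "\<dots> \<le> liminf (\<lambda>n. \<integral>\<^sup>+ \<omega>. ennreal ((X n \<omega>)\<^sup>2) \<partial>M)"
    by (rule nn_integral_liminf) measurable
  also have "\<dots> \<le> ennreal C"
  proof (rule Liminf_le)
    have "(\<integral>\<^sup>+ \<omega>. ennreal ((X n \<omega>)\<^sup>2) \<partial>M) \<le> ennreal C" for n
      using X[of n] bound[of n]
      by (subst nn_integral_eq_integral) (auto simp: square_integrable_def intro: ennreal_leI)
    then show "\<forall>\<^sub>F n in sequentially. (\<integral>\<^sup>+ \<omega>. ennreal ((X n \<omega>)\<^sup>2) \<partial>M) \<le> ennreal C"
      by simp
  qed simp
  finally have "(\<integral>\<^sup>+ \<omega>. ennreal ((Y \<omega>)\<^sup>2) \<partial>M) < \<infinity>"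
    using ennreal_less_top[of C] by (simp add: order_le_less_trans)
  then have "integrable M (\<lambda>\<omega>. (Y \<omega>)\<^sup>2)"
    using Y_meas by (intro integrableI_bounded) auto
  with Y_meas show ?thesis by (simp add: square_integrable_def)
qed

lemma (in prob_space) covariance_self_diff:
  assumes X: "square_integrable M X" and Y: "square_integrable M Y"
  shows "covariance M (\<lambda>\<omega>. X \<omega> - Y \<omega>) (\<lambda>\<omega>. X \<omega> - Y \<omega>) =
    (covariance M X X - covariance M Y X) - (covariance M X Y - covariance M Y Y)"
proof -
  have left: "covariance M (\<lambda>\<omega>. X \<omega> - Y \<omega>) Z = covariance M X Z - covariance M Y Z"
    if Z: "square_integrable M Z" for Z
    using covariance_sum_left[of UNIV "\<lambda>b. if b then X else Y" Z "\<lambda>b. if b then 1 else - 1"] X Y Z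
    by (simp add: UNIV_bool)
  have XY: "square_integrable M (\<lambda>\<omega>. X \<omega> - Y \<omega>)"
    using square_integrable_add[OF X square_integrable_cmult[OF Y, of "- 1"]] by simp
  show ?thesis
    unfolding left[OF XY] covariance_commute[of M _ "\<lambda>\<omega>. X \<omega> - Y \<omega>"] left[OF X] left[OF Y] by simp
qed

lemma (in prob_space) second_moment_covariance:
  assumes "square_integrable M X"
  shows "(LINT \<omega>|M. (X \<omega>)\<^sup>2) = covariance M X X + (LINT \<omega>|M. X \<omega>)\<^sup>2"
  using variance_eq[OF square_integrable_integrable[OF assms]] assms
  by (simp add: square_integrable_def covariance_def power2_eq_square)

context random_cost_function
begin

lemma square_integrable_cost:
  assumes "w \<in> N"
  shows "square_integrable P (J w)"
  using gaussian[of "{w}" "\<lambda>_. 1"] assms gaussian_rv_square_integrable by simp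

lemma differentiable_path:
  assumes "\<omega> \<in> space P" "w \<in> N"
  shows "(\<lambda>v. J v \<omega>) differentiable (at w)"
  using C1_paths[OF assms(1)] assms(2) by (simp add: continuously_differentiable_on_def)

text \<open>A partial derivative is the pointwise limit of difference quotients.  Their variances are
bounded by the smoothness of the covariance function and their means by the differentiability
of the mean function, so their second moments are bounded.\<close>

lemma square_integrable_grad:
  assumes w: "w \<in> N"
  shows "square_integrable P (\<lambda>\<omega>. grad (\<lambda>v. J v \<omega>) w $ i)"
proof -
  obtain d C where d: "0 < d" "ball w d \<subseteq> N" and C: "\<And>h. 0 < h \<Longrightarrow> h < d \<Longrightarrow>
      (let t = w + h *\<^sub>R axis i 1 in
        (covariance P (J t) (J t) - covariance P (J w) (J t)) -
        (covariance P (J t) (J w) - covariance P (J w) (J w))) \<le> C * h\<^sup>2"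
    using smooth_covariance_increment_bound[OF smooth_covariance open_domain w] by blast
  define h where "h n = d / 2 / Suc n" for n
  have h: "0 < h n" "h n < d" for n
  proof -
    show "0 < h n" using d by (simp add: h_def)
    have "h n \<le> d / 2" using d by (simp add: h_def field_simps)
    then show "h n < d" using d by simp
  qed
  have h0: "h \<longlonglongrightarrow> 0"
    unfolding h_def by (rule LIMSEQ_Suc[OF lim_const_over_n])
  define t where "t n = w + h n *\<^sub>R axis i 1" for n
  have tN: "t n \<in> N" for n
    using h[of n] d(2) by (auto simp: t_def dist_norm subset_eq)
  \<comment> \<open>The summand 0 puts the quotient into the form of the affine rules for covariances.\<close>
  define X where "X n \<omega> = 1 / h n * (J (t n) \<omega> - J w \<omega>) + 0" for n \<omega>
  have Jtw: "square_integrable P (\<lambda>\<omega>. J (t n) \<omega> - J w \<omega>)" for n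
    using square_integrable_add[OF square_integrable_cost[OF tN] square_integrable_cmult[OF square_integrable_cost[OF w], of "- 1"]]
    by simp
  have X: "square_integrable P (X n)" for n
    unfolding X_def by (intro square_integrable_add square_integrable_cmult square_integrable_const Jtw)
  have lim: "(\<lambda>n. X n \<omega>) \<longlonglongrightarrow> grad (\<lambda>v. J v \<omega>) w $ i" if "\<omega> \<in> space P" for \<omega>
    using difference_quotient_tendsto_grad[OF differentiable_path[OF that w] h0, of i] h
    by (simp add: X_def t_def less_imp_neq[THEN not_sym])
  have bound: "(LINT \<omega>|P. (X n \<omega>)\<^sup>2) \<le> C + B\<^sup>2"
    if B: "\<And>n. \<bar>LINT \<omega>|P. X n \<omega>\<bar> \<le> B" for n B
  proof -
    have "covariance P (X n) (X n) = (1 / h n)\<^sup>2 * covariance P (\<lambda>\<omega>. J (t n) \<omega> - J w \<omega>) (\<lambda>\<omega>. J (t n) \<omega> - J w \<omega>)"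
      unfolding X_def covariance_affine_left[OF Jtw] covariance_affine_right[OF Jtw]
      by (simp add: power2_eq_square)
    also have "\<dots> \<le> (1 / h n)\<^sup>2 * (C * (h n)\<^sup>2)"
      unfolding covariance_self_diff[OF square_integrable_cost[OF tN] square_integrable_cost[OF w]]
      using C[OF h, of n] by (intro mult_left_mono) (auto simp: Let_def t_def)
    also have "\<dots> = C" using h(1)[of n] by (simp add: power2_eq_square)
    finally have "covariance P (X n) (X n) \<le> C" .
    moreover have "(LINT \<omega>|P. X n \<omega>)\<^sup>2 \<le> B\<^sup>2"
      using B[of n] by (rule abs_le_square_iff[THEN iffD1, OF order_trans]) simp
    ultimately show ?thesis by (simp add: second_moment_covariance[OF X])
  qed
  obtain B where B: "\<And>n. \<bar>LINT \<omega>|P. X n \<omega>\<bar> \<le> B"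
  proof -
    have "(LINT \<omega>|P. X n \<omega>) = (expectation (J (t n)) - expectation (J w)) / h n" for n
      unfolding X_def
      using square_integrable_integrable[OF square_integrable_cost[OF tN[of n]]]
        square_integrable_integrable[OF square_integrable_cost[OF w]] by simp
    then have "(\<lambda>n. LINT \<omega>|P. X n \<omega>) \<longlonglongrightarrow> grad (\<lambda>v. expectation (J v)) w $ i"
      using difference_quotient_tendsto_grad[of "\<lambda>v. expectation (J v)" w h i] C1_mean w h0 h
      by (simp add: t_def continuously_differentiable_on_def less_imp_neq[THEN not_sym])
    then have "Bseq (\<lambda>n. LINT \<omega>|P. X n \<omega>)" by (intro convergent_imp_Bseq convergentI)
    then show ?thesis using that by (auto simp: Bseq_def)
  qed
  show ?thesis by (rule square_integrable_limit[OF X lim bound[OF B]])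
qed

lemma square_integrable_observation:
  assumes "w \<in> N"
  shows "square_integrable_vector P (observation J w)"
  unfolding square_integrable_vector_def
proof
  fix k :: "'n option"
  show "square_integrable P (\<lambda>\<omega>. observation J w \<omega> $ k)"
    using square_integrable_cost[OF assms] square_integrable_grad[OF assms]
    by (cases k) (simp_all add: observation_def value_grad_def)
qed

lemma continuous_on_observation:
  assumes \<omega>: "\<omega> \<in> space P"
  shows "continuous_on N (\<lambda>w. observation J w \<omega>)"
proof -
  have J: "continuous_on N (\<lambda>w. J w \<omega>)"
    using differentiable_path[OF \<omega>] differentiable_imp_continuous_within
    by (blast intro: continuous_at_imp_continuous_on)
  have g: "continuous_on N (\<lambda>w. grad (\<lambda>v. J v \<omega>) w)"
    using C1_paths[OF \<omega>] by (simp add: continuously_differentiable_on_def)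
  show ?thesis
    unfolding observation_def value_grad_def
  proof (rule continuous_on_vec_lambda)
    fix k show "continuous_on N (\<lambda>w. case k of None \<Rightarrow> J w \<omega> | Some i \<Rightarrow> grad (\<lambda>v. J v \<omega>) w $ i)"
      using J g by (cases k) (auto intro: continuous_on_component)
  qed
qed

text \<open>For one fixed \<open>w\<close> the claim is immediate from \<open>covariance_matrix_kernel_AE\<close>.  It is needed for
all \<open>w\<close> at once, outside one null set, because the iterates are random points.  The relevant
equations \<open>u \<bullet> X(w) = c\<close> are indexed by the set \<open>S\<close> of triples \<open>(w, u, c)\<close> with \<open>u\<close> in the
kernel of the covariance matrix at \<open>w\<close> and \<open>c = u \<bullet> E[X(w)]\<close>.  A countable dense subset of
\<open>S\<close> yields countably many almost sure equations, and for a continuous path \<open>w \<mapsto> X(w)\<close> they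
extend to all of \<open>S\<close> by passing to the limit.  The constant \<open>c\<close> is carried in the triple so that
the convergence of the right-hand sides is part of the convergence in \<open>S\<close>.\<close>

lemma AE_all_observations_supported:
  "AE \<omega> in P. \<forall>w\<in>N. in_affine_support P (observation J w) (observation J w \<omega>)"
proof -
  let ?C = "\<lambda>w. covariance_matrix P (observation J w)" and ?m = "\<lambda>w. mean_vector P (observation J w)"
  define S where "S = {(w, u, c). w \<in> N \<and> ?C w *v u = 0 \<and> c = u \<bullet> ?m w}"
  obtain T where T: "countable T" "T \<subseteq> S" "S \<subseteq> closure T" by (rule separable)
  have "AE \<omega> in P. \<forall>(w, u, c)\<in>T. u \<bullet> observation J w \<omega> = c"
  proof (subst AE_ball_countable[OF T(1)], intro ballI, clarify)
    fix w u c assume "(w, u, c) \<in> T"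
    then have "w \<in> N" "?C w *v u = 0" "c = u \<bullet> ?m w" using T(2) by (auto simp: S_def)
    then show "AE \<omega> in P. u \<bullet> observation J w \<omega> = c"
      using covariance_matrix_kernel_AE[OF square_integrable_observation] by simp
  qed
  then show ?thesis
  proof (rule AE_mp[OF _ AE_I2], intro impI ballI)
    fix \<omega> w assume \<omega>: "\<omega> \<in> space P" and T_eq: "\<forall>(w, u, c)\<in>T. u \<bullet> observation J w \<omega> = c" and w: "w \<in> N"
    show "in_affine_support P (observation J w) (observation J w \<omega>)"
      unfolding in_affine_support_def
    proof (intro allI impI)
      fix u assume "?C w *v u = 0"
      then have "(w, u, u \<bullet> ?m w) \<in> closure T" using w T(3) by (auto simp: S_def)
      then obtain p where p: "\<And>n. p n \<in> T" "p \<longlonglongrightarrow> (w, u, u \<bullet> ?m w)"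
        by (auto simp: closure_sequential)
      have pN: "fst (p n) \<in> N" for n using p(1)[of n] T(2) by (auto simp: S_def)
      have lim: "(\<lambda>n. fst (p n)) \<longlonglongrightarrow> w" "(\<lambda>n. fst (snd (p n))) \<longlonglongrightarrow> u"
          "(\<lambda>n. snd (snd (p n))) \<longlonglongrightarrow> u \<bullet> ?m w"
        using tendsto_fst[OF p(2)] tendsto_fst[OF tendsto_snd[OF p(2)]] tendsto_snd[OF tendsto_snd[OF p(2)]]
        by simp_all
      have "(\<lambda>n. observation J (fst (p n)) \<omega>) \<longlonglongrightarrow> observation J w \<omega>"
        by (rule continuous_on_tendsto_compose[OF continuous_on_observation[OF \<omega>] lim(1) w]) (simp add: pN)
      from tendsto_inner[OF lim(2) this]
      have "(\<lambda>n. snd (snd (p n))) \<longlonglongrightarrow> u \<bullet> observation J w \<omega>"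
        using p(1) T_eq by (simp add: case_prod_unfold)
      then show "u \<bullet> observation J w \<omega> = u \<bullet> ?m w" using lim(3) by (rule LIMSEQ_unique)
    qed
  qed
qed

end

section \<open>Equivariance of the iteration\<close>

lemma value_grad_components: "value_grad (x $ None) (\<chi> i. x $ Some i) = x"
  by (simp add: value_grad_def vec_eq_iff split: option.split)

lemma value_grad_add: "value_grad (j + j') (g + g') = value_grad j g + value_grad j' g'"
  by (simp add: value_grad_def vec_eq_iff split: option.split)

lemma block_diagonal_matrix_exists:
  fixes M :: "real ^ 'n ^ 'n"
  assumes "a \<noteq> 0" "invertible M"
  obtains A where "invertible A" "\<And>j g. A *v value_grad j g = value_grad (a * j) (M *v g)"
proof -
  obtain M' where M': "M ** M' = mat 1" using assms(2) by (auto simp: invertible_def)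
  define F where "F c L x = value_grad (c * x $ None) (L *v (\<chi> i. x $ Some i))"
    for c :: real and L :: "real ^ 'n ^ 'n" and x :: "real ^ 'n option"
  have vg: "value_grad j g $ None = j" "(\<chi> i. value_grad j g $ Some i) = g" for j and g :: "real ^ 'n"
    by (simp_all add: value_grad_def)
  have lin: "linear (F c L)" for c L
  proof (rule linearI)
    fix x y :: "real ^ 'n option" and r :: real
    have *: "(\<chi> i. (x + y) $ Some i) = (\<chi> i. x $ Some i) + (\<chi> i. y $ Some i)"
      "(\<chi> i. (r *\<^sub>R x) $ Some i) = r *\<^sub>R (\<chi> i. x $ Some i)" by (simp_all add: vec_eq_iff)
    show "F c L (x + y) = F c L x + F c L y"
      unfolding F_def * by (simp add: matrix_vector_right_distrib distrib_left value_grad_add)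
    show "F c L (r *\<^sub>R x) = r *\<^sub>R F c L x"
      unfolding F_def * matrix_vector_mult_scaleR
      by (simp add: value_grad_def vec_eq_iff split: option.split)
  qed
  have F: "matrix (F c L) *v value_grad j g = value_grad (c * j) (L *v g)" for c L j g
    by (simp add: matrix_works lin) (simp add: F_def vg)
  have "matrix (F a M) *v (matrix (F (1 / a) M') *v value_grad j g) = value_grad j g" for j g
    unfolding F using assms(1) M' by (simp add: matrix_vector_mul_assoc)
  from this[of "x $ None" "\<chi> i. x $ Some i" for x]
  have "matrix (F a M) *v (matrix (F (1 / a) M') *v x) = x" for x
    unfolding value_grad_components .
  then have "matrix (F a M) ** matrix (F (1 / a) M') = mat 1"
    by (simp add: matrix_eq flip: matrix_vector_mul_assoc)
  then have "invertible (matrix (F a M))" using invertible_right_inverse by blast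
  then show thesis using F that by blast
qed

lemma is_arg_min_arg_min_on:
  assumes "\<exists>!\<theta>. is_arg_min f (\<lambda>\<theta>. \<theta> \<in> N) \<theta>"
  shows "is_arg_min f (\<lambda>\<theta>. \<theta> \<in> N) (arg_min_on f N)"
  unfolding arg_min_on_def arg_min_def using assms by (blast intro: someI_ex)

lemma arg_min_on_transport:
  fixes f :: "'a \<Rightarrow> real"
  assumes bij: "bij_betw \<phi> M N" and ex1: "\<exists>!\<theta>. is_arg_min f (\<lambda>\<theta>. \<theta> \<in> N) \<theta>"
    and a: "a > 0" and f': "\<And>v. v \<in> M \<Longrightarrow> f' v = a * f (\<phi> v) + b"
  shows "arg_min_on f' M = the_inv_into M \<phi> (arg_min_on f N)"
proof -
  let ?\<theta> = "arg_min_on f N"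
  have \<theta>: "is_arg_min f (\<lambda>\<theta>. \<theta> \<in> N) ?\<theta>"
    by (rule is_arg_min_arg_min_on[OF ex1])
  then have N: "?\<theta> \<in> N" by (simp add: is_arg_min_def)
  have img: "\<phi> ` M = N" and inj: "inj_on \<phi> M" using bij by (auto simp: bij_betw_def)
  have iff: "is_arg_min f' (\<lambda>v. v \<in> M) v \<longleftrightarrow> v \<in> M \<and> is_arg_min f (\<lambda>\<theta>. \<theta> \<in> N) (\<phi> v)" for v
    using a f' by (auto simp: is_arg_min_linorder simp flip: img)
  have inv: "the_inv_into M \<phi> ?\<theta> \<in> M" "\<phi> (the_inv_into M \<phi> ?\<theta>) = ?\<theta>"
    using N inj img by (auto simp: the_inv_into_into f_the_inv_into_f)
  show "arg_min_on f' M = the_inv_into M \<phi> ?\<theta>"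
    unfolding arg_min_on_def[of f'] arg_min_def
  proof (rule some_equality)
    show "is_arg_min f' (\<lambda>x. x \<in> M) (the_inv_into M \<phi> ?\<theta>)" using iff inv \<theta> by simp
    fix v assume "is_arg_min f' (\<lambda>x. x \<in> M) v"
    then have "v \<in> M" "\<phi> v = ?\<theta>" using iff ex1 \<theta> by blast+
    then show "v = the_inv_into M \<phi> ?\<theta>" using inj by (metis the_inv_into_f_f)
  qed
qed

abbreviation sample_taylor ::
  "'w measure \<Rightarrow> (real ^ 'n \<Rightarrow> 'w \<Rightarrow> real) \<Rightarrow> real ^ 'n \<Rightarrow> 'w \<Rightarrow> real ^ 'n \<Rightarrow> real" where
  "sample_taylor P J w \<omega> \<equiv> taylor_approx P J w (J w \<omega>) (grad (\<lambda>v. J v \<omega>) w)"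

lemma AE_rfd_in_domain:
  assumes "w0 \<in> N" "rfd_well_defined P N J w0"
  shows "AE \<omega> in P. \<forall>n. rfd P N J w0 n \<omega> \<in> N"
  using assms(2)[unfolded rfd_well_defined_def]
proof eventually_elim
  fix \<omega>
  assume ex1: "\<forall>n. \<exists>!\<theta>. is_arg_min (sample_taylor P J (rfd P N J w0 n \<omega>) \<omega>) (\<lambda>\<theta>. \<theta> \<in> N) \<theta>"
  show "\<forall>n. rfd P N J w0 n \<omega> \<in> N"
  proof
    fix n show "rfd P N J w0 n \<omega> \<in> N"
      using assms(1) is_arg_min_arg_min_on[OF ex1[rule_format]]
      by (cases n) (simp_all add: rfd_step_def is_arg_min_def)
  qed
qed

context random_cost_function
begin

text \<open>By the chain rule the pair of value and gradient of \<open>a J(\<phi>(v)) + b\<close> at \<open>v\<close> is the image of the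
one of \<open>J\<close> at \<open>\<phi>(v)\<close> under the affine map with block diagonal linear part
\<open>diag(a, a D\<phi>(v)\<^sup>T)\<close>, which is deterministic and invertible.\<close>

lemma sample_taylor_transport:
  fixes \<phi> :: "real ^ 'n \<Rightarrow> real ^ 'n"
  assumes a: "a > 0" and \<phi>: "\<phi> differentiable (at v)" "invertible (jacobian \<phi> (at v))"
    and v: "\<phi> v \<in> N" and \<theta>: "\<phi> \<theta> \<in> N" and \<omega>: "\<omega> \<in> space P"
    and supp: "in_affine_support P (observation J (\<phi> v)) (observation J (\<phi> v) \<omega>)"
  shows "sample_taylor P (\<lambda>v \<omega>. a * J (\<phi> v) \<omega> + b) v \<omega> \<theta> = a * sample_taylor P J (\<phi> v) \<omega> (\<phi> \<theta>) + b"
proof -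
  let ?J = "\<lambda>v \<omega>. a * J (\<phi> v) \<omega> + b"
  have "invertible (a *\<^sub>R transpose (jacobian \<phi> (at v)))"
    using a \<phi>(2) by (intro scalar_invertible) (auto simp: transpose_invertible)
  then obtain A where A: "invertible A" "\<And>j g. A *v value_grad j g =
      value_grad (a * j) ((a *\<^sub>R transpose (jacobian \<phi> (at v))) *v g)"
    using block_diagonal_matrix_exists a by (metis less_irrefl)
  have obs: "observation ?J v \<omega> = A *v observation J (\<phi> v) \<omega> + value_grad b 0" if \<omega>: "\<omega> \<in> space P" for \<omega>
  proof -
    note J = differentiable_path[OF \<omega> v]
    have "(\<lambda>v. J (\<phi> v) \<omega>) differentiable (at v)"
      using differentiable_chain_at[OF \<phi>(1) J] by (simp add: o_def)
    then have "grad (\<lambda>v. ?J v \<omega>) v = (a *\<^sub>R transpose (jacobian \<phi> (at v))) *v grad (\<lambda>v. J v \<omega>) (\<phi> v)"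
      by (simp only: grad_affine grad_compose[OF J \<phi>(1)] scaleR_matrix_vector_assoc)
    then show ?thesis by (simp add: observation_def A(2) flip: value_grad_add)
  qed
  have "sample_taylor P ?J v \<omega> \<theta> = gaussian_predictor P (?J \<theta>) (observation ?J v) (observation ?J v \<omega>)"
    by (simp add: taylor_approx_gaussian_predictor observation_def)
  also have "\<dots> = gaussian_predictor P (\<lambda>\<omega>. a * J (\<phi> \<theta>) \<omega> + b)
      (\<lambda>\<omega>. A *v observation J (\<phi> v) \<omega> + value_grad b 0) (A *v observation J (\<phi> v) \<omega> + value_grad b 0)"
    unfolding obs[OF \<omega>] by (rule gaussian_predictor_cong) (simp_all add: obs)
  also have "\<dots> = a * gaussian_predictor P (J (\<phi> \<theta>)) (observation J (\<phi> v)) (observation J (\<phi> v) \<omega>) + b"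
    by (rule gaussian_predictor_affine[OF square_integrable_observation[OF v] square_integrable_cost[OF \<theta>] A(1) supp])
  finally show ?thesis
    by (simp add: taylor_approx_gaussian_predictor observation_def)
qed

text \<open>Both kinds of rescaling at once.  On the almost sure event where all observations lie in the
affine supports and all minimizers are unique, the objectives of the two iterations correspond
under \<open>\<phi>\<close> up to an increasing affine map, hence so do their minimizers.\<close>

theorem rfd_equivariant:
  fixes \<phi> :: "real ^ 'n \<Rightarrow> real ^ 'n"
  assumes wd: "rfd_well_defined P N J w0" and w0: "w0 \<in> N" and a: "a > 0"
    and bij: "bij_betw \<phi> M N"
    and \<phi>: "\<And>v. v \<in> M \<Longrightarrow> \<phi> differentiable (at v) \<and> invertible (jacobian \<phi> (at v))"
  shows "AE \<omega> in P. rfd P M (\<lambda>v \<omega>. a * J (\<phi> v) \<omega> + b) (the_inv_into M \<phi> w0) n \<omega> =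
    the_inv_into M \<phi> (rfd P N J w0 n \<omega>)"
  using wd[unfolded rfd_well_defined_def] AE_all_observations_supported
    AE_rfd_in_domain[OF w0 wd] AE_space
proof eventually_elim
  fix \<omega>
  let ?J = "\<lambda>v \<omega>. a * J (\<phi> v) \<omega> + b"
  let ?W = "\<lambda>n. rfd P N J w0 n \<omega>" and ?V = "\<lambda>n. rfd P M ?J (the_inv_into M \<phi> w0) n \<omega>"
  assume ex1: "\<forall>n. \<exists>!\<theta>. is_arg_min (sample_taylor P J (?W n) \<omega>) (\<lambda>\<theta>. \<theta> \<in> N) \<theta>"
    and supp: "\<forall>w\<in>N. in_affine_support P (observation J w) (observation J w \<omega>)"
    and W: "\<forall>n. ?W n \<in> N" and \<omega>: "\<omega> \<in> space P"
  have img: "\<phi> ` M = N" and inj: "inj_on \<phi> M" using bij by (auto simp: bij_betw_def)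
  show "?V n = the_inv_into M \<phi> (?W n)"
  proof (induction n)
    case 0
    then show ?case by simp
  next
    case (Suc n)
    then have V: "?V n \<in> M" "\<phi> (?V n) = ?W n"
      using W inj img by (auto simp: the_inv_into_into f_the_inv_into_f)
    have taylor: "sample_taylor P ?J (?V n) \<omega> \<theta> = a * sample_taylor P J (?W n) \<omega> (\<phi> \<theta>) + b"
      if "\<theta> \<in> M" for \<theta>
    proof -
      have "\<phi> \<theta> \<in> N" using that img by auto
      then show ?thesis
        using sample_taylor_transport[OF a, of \<phi> "?V n" \<theta> \<omega> b] \<phi>[OF V(1)] W \<omega> supp
        unfolding V(2) by blast
    qed
    from arg_min_on_transport[OF bij ex1[rule_format, of n] a taylor]
    show ?case by (simp add: rfd_step_def)
  qed
qed

end

theorem mainTheorem2: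
  fixes P :: "'w measure"
    and N :: "(real ^ 'n) set"
    and J :: "real ^ 'n \<Rightarrow> 'w \<Rightarrow> real"
    and w0 :: "real ^ 'n"
  assumes "random_cost_function P N J"
    and "w0 \<in> N"
    and "rfd_well_defined P N J w0"
  shows "(\<forall>(a::real) (b::real). a > 0 \<longrightarrow>
           (\<forall>n. AE \<omega> in P. rfd P N (\<lambda>w \<omega>. a * J w \<omega> + b) w0 n \<omega> = rfd P N J w0 n \<omega>))
       \<and> (\<forall>(M :: (real ^ 'n) set) (\<phi> :: real ^ 'n \<Rightarrow> real ^ 'n).
           open M \<and> bij_betw \<phi> M N \<and>
           (\<forall>v\<in>M. \<phi> differentiable (at v) \<and> invertible (jacobian \<phi> (at v))) \<longrightarrow>
           (\<forall>n. AE \<omega> in P.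
              rfd P M (\<lambda>v. J (\<phi> v)) (the_inv_into M \<phi> w0) n \<omega>
                = the_inv_into M \<phi> (rfd P N J w0 n \<omega>)))"
proof -
  interpret random_cost_function P N J by fact
  note equivariant = rfd_equivariant[OF assms(3,2)]
  show ?thesis
  proof (intro conjI allI impI)
    fix a b :: real and n assume a: "a > 0"
    have "jacobian (\<lambda>v. v) (at v) = mat 1" for v :: "real ^ 'n"
      by (simp add: jacobian_def matrix_id_mat_1[unfolded id_def])
    then have "AE \<omega> in P. rfd P N (\<lambda>w \<omega>. a * J w \<omega> + b) (the_inv_into N (\<lambda>v. v) w0) n \<omega>
        = the_inv_into N (\<lambda>v. v) (rfd P N J w0 n \<omega>)"
      by (intro equivariant[OF a, of "\<lambda>v. v" N b n])
         (auto simp: bij_betw_def inj_on_def invertible_def intro: exI[of _ "mat 1"])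
    moreover have "the_inv_into N (\<lambda>v. v) w = w" if "w \<in> N" for w
      using the_inv_into_f_f[of "\<lambda>v. v" N w] that by (simp add: inj_on_def)
    ultimately show "AE \<omega> in P. rfd P N (\<lambda>w \<omega>. a * J w \<omega> + b) w0 n \<omega> = rfd P N J w0 n \<omega>"
      using AE_rfd_in_domain[OF assms(2,3)] assms(2) by (auto elim: eventually_elim2)
  next
    fix M :: "(real ^ 'n) set" and \<phi> :: "real ^ 'n \<Rightarrow> real ^ 'n" and n
    assume "open M \<and> bij_betw \<phi> M N \<and>
      (\<forall>v\<in>M. \<phi> differentiable (at v) \<and> invertible (jacobian \<phi> (at v)))"
    then show "AE \<omega> in P. rfd P M (\<lambda>v. J (\<phi> v)) (the_inv_into M \<phi> w0) n \<omega>
        = the_inv_into M \<phi> (rfd P N J w0 n \<omega>)"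
      using equivariant[OF zero_less_one, of \<phi> M 0 n] by simp
  qed
qed

end
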